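(* Let $X,Y$ be countable subsets of $[0,\infty)$ and let $S\subset X\times Y$. If $S$ is fully erasable, then the WEP holds for $S$.
   Context: For $S\subset X\times Y$: $S_X=\{x\in X:\exists y\in Y,\ (x,y)\in S\}$, $S_Y=\{y\in Y:\exists x\in X,\ (x,y)\in S\}$, $Y_S(x)=\{y\in Y:(x,y)\in S\}$, $X_S(y)=\{x\in X:(x,y)\in S\}$. Erasure transformations: $\mathcal E_{1,x}(S)=S\setminus\{(x,y)\in S:|X_S(y)|=1\}$; $\mathcal E_{k,y}(S)=S\setminus\{(x,y)\in S:|Y_S(x)|=k\}$ for $k=1,2$; and $\mathcal E=\mathcal E_{2,y}\circ\mathcal E_{1,y}\circ\mathcal E_{1,x}$. The set $S$ is fully erasable if for every $(x,y)\in S$ there exists $n\in\mathbb N$ such that $(x,y)\notin\mathcal E^n(S)$ (with $\mathcal E^0=\mathrm{id}$). The WEP (weak exact predictable representation property) holds for $S$ if for every function $f:S\to\mathbb R$ there exist functions $\varphi,h:S_X\to\mathbb R$ and $\psi:S_Y\to\mathbb R$ with $f(x,y)=\varphi(x)+h(x)(y-x)-\psi(y)$ for all $(x,y)\in S$. *)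

theory Defs
  imports Complex_Main "HOL-Library.Countable_Set"
begin

text \<open>
  The ambient sets \<open>X\<close> and \<open>Y\<close> are not parameters of the sections: for \<open>S \<subseteq> X \<times> Y\<close> the conditions
  \<open>x \<in> X\<close> and \<open>y \<in> Y\<close> follow from \<open>(x, y) \<in> S\<close>.
\<close>

definition X_section :: "('a \<times> 'b) set \<Rightarrow> 'b \<Rightarrow> 'a set" where
  "X_section S y = {x. (x, y) \<in> S}"

definition Y_section :: "('a \<times> 'b) set \<Rightarrow> 'a \<Rightarrow> 'b set" where
  "Y_section S x = {y. (x, y) \<in> S}"

text \<open>
  Infinite sections have \<^const>\<open>card\<close> 0. Cardinalities are only compared with 1 and 2 below, so
  points on infinite sections are correctly kept.
\<close>

definition erase_1x :: "('a \<times> 'b) set \<Rightarrow> ('a \<times> 'b) set" where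
  "erase_1x S = S - {(x, y) \<in> S. card (X_section S y) = 1}"

definition erase_y :: "nat \<Rightarrow> ('a \<times> 'b) set \<Rightarrow> ('a \<times> 'b) set" where
  "erase_y k S = S - {(x, y) \<in> S. card (Y_section S x) = k}"

definition erase :: "('a \<times> 'b) set \<Rightarrow> ('a \<times> 'b) set" where
  "erase = erase_y 2 \<circ> erase_y 1 \<circ> erase_1x"

definition fully_erasable :: "('a \<times> 'b) set \<Rightarrow> bool" where
  "fully_erasable S \<longleftrightarrow> (\<forall>(x, y) \<in> S. \<exists>n. (x, y) \<notin> (erase ^^ n) S)"

text \<open>
  Functions on \<open>S\<close> and on its projections \<^term>\<open>Domain S\<close> and \<^term>\<open>Range S\<close> are represented by total
  functions; the condition only involves their values on \<open>S\<close> and these projections.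
\<close>

definition WEP :: "(real \<times> real) set \<Rightarrow> bool" where
  "WEP S \<longleftrightarrow> (\<forall>f :: real \<times> real \<Rightarrow> real. \<exists>(\<phi> :: real \<Rightarrow> real) (h :: real \<Rightarrow> real) (\<psi> :: real \<Rightarrow> real).
     \<forall>(x, y) \<in> S. f (x, y) = \<phi> x + h x * (y - x) - \<psi> y)"

end

theory Submission
  imports Defs "HOL-Library.Function_Algebras"
begin

text \<open>
  The WEP is an infinite linear system, one equation for each point of \<open>S\<close>, with finitely many
  unknowns per equation. It is solvable for all right-hand sides as soon as its left-hand sides are
  linearly independent, since a linear functional may then be prescribed on them. A nontrivial
  relation would have a finite nonempty support, and the first erasure step that touches this support
  would force one of its coefficients to vanish; hence the support survives all erasures, which
  is impossible in a fully erasable set.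
\<close>

text \<open>If \<open>p\<close> is the only point of \<open>T\<close> with second coordinate
  \<open>y\<close>, the balance sum at \<open>y\<close> has the single term \<open>c p\<close>,
  which is nonzero.\<close>

lemma subset_erase_1x:
  fixes c :: "'a \<times> 'b \<Rightarrow> real"
  assumes "F \<subseteq> T" and nz: "\<And>p. p \<in> F \<Longrightarrow> c p \<noteq> 0"
    and bal: "\<And>y. (\<Sum>p | p \<in> F \<and> snd p = y. c p) = 0"
  shows "F \<subseteq> erase_1x T"
proof (rule subsetI, rule ccontr)
  fix p assume p: "p \<in> F" "p \<notin> erase_1x T"
  obtain x y where xy: "p = (x, y)" by (cases p)
  with p \<open>F \<subseteq> T\<close> have "card (X_section T y) = 1"
    by (auto simp: erase_1x_def)
  moreover have "x \<in> X_section T y"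
    using p xy \<open>F \<subseteq> T\<close> by (auto simp: X_section_def)
  ultimately have "X_section T y = {x}"
    by (metis card_1_singletonE singletonD)
  then have "{q. q \<in> F \<and> snd q = y} = {p}"
    using p xy \<open>F \<subseteq> T\<close> by (auto simp: X_section_def)
  with bal[of y] nz[OF p(1)] show False by simp
qed

lemma subset_erase_y_1:
  fixes c :: "'a \<times> 'b \<Rightarrow> real"
  assumes "F \<subseteq> T" and nz: "\<And>p. p \<in> F \<Longrightarrow> c p \<noteq> 0"
    and bal: "\<And>x. (\<Sum>p | p \<in> F \<and> fst p = x. c p) = 0"
  shows "F \<subseteq> erase_y 1 T"
proof (rule subsetI, rule ccontr)
  fix p assume p: "p \<in> F" "p \<notin> erase_y 1 T"
  obtain x y where xy: "p = (x, y)" by (cases p)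
  with p \<open>F \<subseteq> T\<close> have "card (Y_section T x) = 1"
    by (auto simp: erase_y_def)
  moreover have "y \<in> Y_section T x"
    using p xy \<open>F \<subseteq> T\<close> by (auto simp: Y_section_def)
  ultimately have "Y_section T x = {y}"
    by (metis card_1_singletonE singletonD)
  then have "{q. q \<in> F \<and> fst q = x} = {p}"
    using p xy \<open>F \<subseteq> T\<close> by (auto simp: Y_section_def)
  with bal[of x] nz[OF p(1)] show False by simp
qed

text \<open>Two unknowns per row (\<open>\<phi>\<close> and \<open>h\<close>) give two conditions on
  the coefficients over \<open>x\<close>; on two points with distinct second coordinates these force
  both coefficients to be 0.\<close>

lemma subset_erase_y_2:
  fixes c :: "real \<times> real \<Rightarrow> real"
  assumes "F \<subseteq> T" and nz: "\<And>p. p \<in> F \<Longrightarrow> c p \<noteq> 0"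
    and bal: "\<And>x. (\<Sum>p | p \<in> F \<and> fst p = x. c p) = 0"
    and mart: "\<And>x. (\<Sum>p | p \<in> F \<and> fst p = x. c p * (snd p - x)) = 0"
  shows "F \<subseteq> erase_y 2 T"
proof (rule subsetI, rule ccontr)
  fix p assume p: "p \<in> F" "p \<notin> erase_y 2 T"
  obtain x y where xy: "p = (x, y)" by (cases p)
  with p \<open>F \<subseteq> T\<close> have "card (Y_section T x) = 2"
    by (auto simp: erase_y_def)
  moreover have "y \<in> Y_section T x"
    using p xy \<open>F \<subseteq> T\<close> by (auto simp: Y_section_def)
  ultimately obtain z where z: "Y_section T x = {y, z}" "y \<noteq> z"
    by (metis card_2_iff insert_commute insertE singletonD)
  have sub: "{q. q \<in> F \<and> fst q = x} \<subseteq> {p, (x, z)}"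
    using z \<open>F \<subseteq> T\<close> xy by (force simp: Y_section_def)
  show False
  proof (cases "(x, z) \<in> F")
    case False
    with sub p xy have "{q. q \<in> F \<and> fst q = x} = {p}" by force
    with bal[of x] nz[OF p(1)] show False by simp
  next
    case True
    with sub p xy have eq: "{q. q \<in> F \<and> fst q = x} = {p, (x, z)}" by force
    have "c p + c (x, z) = 0" "c p * (y - x) + c (x, z) * (z - x) = 0"
      using bal[of x] mart[of x] z(2) xy by (simp_all add: eq)
    \<comment> \<open>Subtract \<open>z - x\<close> times the first equation from the
      second.\<close>
    then have "c p * (y - z) = 0" by algebra
    with z(2) nz[OF p(1)] show False by simp
  qed
qed

text \<open>The three families of sums are, up to sign, the coordinates of a linear relation at the
  unknowns \<open>Psi y\<close>, \<open>Phi x\<close> and \<open>H x\<close>.\<close>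

lemma fully_erasable_relation_trivial:
  fixes c :: "real \<times> real \<Rightarrow> real"
  assumes S: "fully_erasable S" and F: "F \<subseteq> S" and nz: "\<And>p. p \<in> F \<Longrightarrow> c p \<noteq> 0"
    and "\<And>y. (\<Sum>p | p \<in> F \<and> snd p = y. c p) = 0"
    and "\<And>x. (\<Sum>p | p \<in> F \<and> fst p = x. c p) = 0"
    and "\<And>x. (\<Sum>p | p \<in> F \<and> fst p = x. c p * (snd p - x)) = 0"
  shows "F = {}"
proof -
  have "F \<subseteq> erase T" if "F \<subseteq> T" for T
    unfolding erase_def o_apply
    by (rule subset_erase_y_2[where c = c], rule subset_erase_y_1[where c = c],
        rule subset_erase_1x[where c = c]) (use that assms in auto)
  then have "F \<subseteq> (erase ^^ n) S" for n
    using F by (induction n) auto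
  with S F show ?thesis
    unfolding fully_erasable_def by fast
qed

datatype unknown = Phi real | H real | Psi real

definition unit_vec :: "'i \<Rightarrow> 'i \<Rightarrow> real" where
  "unit_vec i = (\<lambda>j. of_bool (j = i))"

definition scale_fun :: "real \<Rightarrow> ('i \<Rightarrow> real) \<Rightarrow> 'i \<Rightarrow> real" where
  "scale_fun r u = (\<lambda>i. r * u i)"

text \<open>The coefficient vector of the left-hand side of the WEP equation at
  \<open>p\<close>.\<close>

definition equation_vec :: "real \<times> real \<Rightarrow> unknown \<Rightarrow> real" where
  "equation_vec p = unit_vec (Phi (fst p)) + scale_fun (snd p - fst p) (unit_vec (H (fst p)))
     - unit_vec (Psi (snd p))"

lemma equation_vec_simps [simp]:
  "equation_vec p (Phi x) = of_bool (fst p = x)"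
  "equation_vec p (H x) = (snd p - x) * of_bool (fst p = x)"
  "equation_vec p (Psi y) = - of_bool (snd p = y)"
  by (auto simp: equation_vec_def unit_vec_def scale_fun_def)

text \<open>Injectivity allows relations to be indexed by points instead of vectors, and values to
  be prescribed through \<open>inv equation_vec\<close>.\<close>

lemma inj_equation_vec: "inj equation_vec"
proof (rule injI)
  fix p q assume "equation_vec p = equation_vec q"
  from fun_cong[OF this, of "Phi (fst p)"] fun_cong[OF this, of "Psi (snd p)"]
  show "p = q" by (auto intro: prod_eqI split: if_splits)
qed

lemma sum_fun_apply: "(\<Sum>a\<in>A. u a) i = (\<Sum>a\<in>A. u a i)"
  for u :: "'a \<Rightarrow> 'i \<Rightarrow> real"
  by (induction A rule: infinite_finite_induct) auto

interpretation fun_space: vector_space scale_fun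
  by unfold_locales (auto simp: scale_fun_def algebra_simps)

interpretation functional: vector_space_pair scale_fun "(*) :: real \<Rightarrow> real \<Rightarrow> real"
  by unfold_locales (auto simp: algebra_simps)

lemma independent_equation_vec:
  assumes "fully_erasable S"
  shows "fun_space.independent (equation_vec ` S)"
proof
  assume "fun_space.dependent (equation_vec ` S)"
  then obtain t u where t: "finite t" "t \<subseteq> equation_vec ` S"
      and rel: "(\<Sum>v\<in>t. scale_fun (u v) v) = 0" and nz: "\<exists>v\<in>t. u v \<noteq> 0"
    unfolding fun_space.dependent_explicit by blast
  define c where "c = u \<circ> equation_vec"
  \<comment> \<open>The support of the relation; the vectors of \<open>t\<close> left out have
    coefficient 0, so the sums do not change.\<close>
  define F where "F = {p \<in> S. equation_vec p \<in> t \<and> c p \<noteq> 0}"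
  have inj: "inj_on equation_vec A" for A
    using inj_equation_vec inj_on_subset by blast
  have fin: "finite F"
    using finite_vimageI[OF t(1) inj_equation_vec] by (auto simp: F_def elim: rev_finite_subset)
  have coord: "(\<Sum>p\<in>F. c p * equation_vec p i) = 0" for i
  proof -
    have "(\<Sum>p\<in>F. c p * equation_vec p i) = (\<Sum>v\<in>equation_vec ` F. u v * v i)"
      by (simp add: sum.reindex[OF inj] c_def)
    also have "\<dots> = (\<Sum>v\<in>t. u v * v i)"
      using t by (intro sum.mono_neutral_left) (auto simp: F_def c_def)
    also have "\<dots> = 0"
      using fun_cong[OF rel, of i] by (simp add: sum_fun_apply scale_fun_def)
    finally show ?thesis .
  qed
  have "F = {}"
  proof (rule fully_erasable_relation_trivial[OF assms, of F c])
    show "(\<Sum>p | p \<in> F \<and> snd p = y. c p) = 0" for y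
      using coord[of "Psi y"] fin by (simp add: sum_negf sum_mult_of_bool_eq Int_def)
    show "(\<Sum>p | p \<in> F \<and> fst p = x. c p) = 0" for x
      using coord[of "Phi x"] fin by (simp add: sum_mult_of_bool_eq Int_def)
    show "(\<Sum>p | p \<in> F \<and> fst p = x. c p * (snd p - x)) = 0" for x
      using coord[of "H x"] fin by (simp add: mult.assoc[symmetric] sum_mult_of_bool_eq Int_def)
  qed (auto simp: F_def)
  with nz t show False by (auto simp: F_def c_def)
qed

theorem proposition5p19:
  fixes X Y :: "real set" and S :: "(real \<times> real) set"
  assumes "countable X" and "X \<subseteq> {0..}"
    and "countable Y" and "Y \<subseteq> {0..}"
    and "S \<subseteq> X \<times> Y"
    and "fully_erasable S"
  shows "WEP S"
  unfolding WEP_def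
proof (intro allI)
  fix f :: "real \<times> real \<Rightarrow> real"
  \<comment> \<open>Values prescribed on an independent set extend to a linear functional on the
    whole space; here the prescribed values are the right-hand sides.\<close>
  obtain g where g: "Vector_Spaces.linear scale_fun (*) g"
      and ext: "\<forall>v\<in>equation_vec ` S. g v = f (inv equation_vec v)"
    using functional.linear_independent_extend[OF independent_equation_vec[OF \<open>fully_erasable S\<close>],
      of "\<lambda>v. f (inv equation_vec v)"]
    by blast
  interpret g: Vector_Spaces.linear scale_fun "(*)" g by (rule g)
  \<comment> \<open>The values of \<open>g\<close> at the unit vectors solve the system: each
    equation vector is a finite combination of them, so linearity alone suffices.\<close>
  have "f (x, y) = g (unit_vec (Phi x)) + g (unit_vec (H x)) * (y - x) - g (unit_vec (Psi y))"
    if "(x, y) \<in> S" for x y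
  proof -
    have "f (x, y) = g (equation_vec (x, y))"
      using that ext by (simp add: inv_f_f[OF inj_equation_vec])
    also have "\<dots> = g (unit_vec (Phi x)) + (y - x) * g (unit_vec (H x)) - g (unit_vec (Psi y))"
      by (simp add: equation_vec_def g.add g.diff g.scale)
    finally show ?thesis by (simp add: mult.commute)
  qed
  then show "\<exists>\<phi> h \<psi>. \<forall>(x, y) \<in> S. f (x, y) = \<phi> x + h x * (y - x) - \<psi> y"
    by (intro exI[of _ "\<lambda>x. g (unit_vec (Phi x))"] exI[of _ "\<lambda>x. g (unit_vec (H x))"]
        exI[of _ "\<lambda>y. g (unit_vec (Psi y))"]) auto
qed

end
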